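(* The $\mathrm{dup}$-number is invariant under isomorphism: if $\mathfrak g$ and $\mathfrak g'$ are quadratic Lie algebras that are isomorphic as Lie algebras, then $\mathrm{dup}(\mathfrak g)=\mathrm{dup}(\mathfrak g')$.
   Context: All vector spaces are finite-dimensional over $\mathbb C$. A quadratic Lie algebra $(\mathfrak g,B)$ is a Lie algebra with a non-degenerate symmetric invariant bilinear form $B$, i.e. $B([X,Y],Z)=B(X,[Y,Z])$. Its associated 3-form is $I(X,Y,Z)=B([X,Y],Z)$, and its $\mathrm{dup}$-number is $\mathrm{dup}(\mathfrak g)=\dim\{\alpha\in\mathfrak g^*\mid\alpha\wedge I=0\}$, which a priori depends on $B$. The isomorphism between $\mathfrak g$ and $\mathfrak g'$ is not required to be an isometry. *)

theory Defs
  imports Complex_Main "HOL-Library.Function_Algebras"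
begin

text \<open>Vector spaces are given by a scalar multiplication of the complex numbers on a type, so
  that the two Lie algebras being compared may live on different types.\<close>

locale complex_lie_algebra = vector_space scale
  for scale :: "complex \<Rightarrow> 'a::ab_group_add \<Rightarrow> 'a" +
  fixes bracket :: "'a \<Rightarrow> 'a \<Rightarrow> 'a"
  assumes finite_dimensional: "\<exists>Basis. finite_dimensional_vector_space scale Basis"
    and linear_bracket_left: "Vector_Spaces.linear scale scale (\<lambda>x. bracket x y)"
    and linear_bracket_right: "Vector_Spaces.linear scale scale (\<lambda>y. bracket x y)"
    and bracket_self: "bracket x x = 0"
    and jacobi: "bracket x (bracket y z) + bracket y (bracket z x) + bracket z (bracket x y) = 0"

locale quadratic_lie_algebra = complex_lie_algebra scale bracket
  for scale :: "complex \<Rightarrow> 'a::ab_group_add \<Rightarrow> 'a"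
    and bracket :: "'a \<Rightarrow> 'a \<Rightarrow> 'a" +
  fixes B :: "'a \<Rightarrow> 'a \<Rightarrow> complex"
  assumes linear_form_left: "Vector_Spaces.linear scale (*) (\<lambda>x. B x y)"
    and linear_form_right: "Vector_Spaces.linear scale (*) (\<lambda>y. B x y)"
    and form_symmetric: "B x y = B y x"
    and form_invariant: "B (bracket x y) z = B x (bracket y z)"
    and form_nondegenerate: "(\<forall>y. B x y = 0) \<Longrightarrow> x = 0"

definition lie_algebra_iso ::
    "(complex \<Rightarrow> 'a::ab_group_add \<Rightarrow> 'a) \<Rightarrow> ('a \<Rightarrow> 'a \<Rightarrow> 'a) \<Rightarrow>
     (complex \<Rightarrow> 'b::ab_group_add \<Rightarrow> 'b) \<Rightarrow> ('b \<Rightarrow> 'b \<Rightarrow> 'b) \<Rightarrow> ('a \<Rightarrow> 'b) \<Rightarrow> bool" where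
  "lie_algebra_iso scale bracket scale' bracket' \<phi> \<longleftrightarrow>
     Vector_Spaces.linear scale scale' \<phi> \<and> bij \<phi> \<and>
     (\<forall>x y. \<phi> (bracket x y) = bracket' (\<phi> x) (\<phi> y))"

definition assoc_3form ::
    "('a \<Rightarrow> 'a \<Rightarrow> 'a) \<Rightarrow> ('a \<Rightarrow> 'a \<Rightarrow> complex) \<Rightarrow> 'a \<Rightarrow> 'a \<Rightarrow> 'a \<Rightarrow> complex" where
  "assoc_3form bracket B x y z = B (bracket x y) z"

text \<open>The exterior product of a 1-form and a 3-form, as the signed sum over the
  (1,3)-shuffles.\<close>

definition wedge_1_3 ::
    "('a \<Rightarrow> complex) \<Rightarrow> ('a \<Rightarrow> 'a \<Rightarrow> 'a \<Rightarrow> complex) \<Rightarrow> 'a \<Rightarrow> 'a \<Rightarrow> 'a \<Rightarrow> 'a \<Rightarrow> complex" where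
  "wedge_1_3 \<alpha> \<omega> x y z w =
     \<alpha> x * \<omega> y z w - \<alpha> y * \<omega> x z w + \<alpha> z * \<omega> x y w - \<alpha> w * \<omega> x y z"

text \<open>The dual space is a subspace of the space of all functions from the type to the
  complex numbers; dimensions of spaces of linear forms are taken there.\<close>

definition fun_scale :: "complex \<Rightarrow> ('a \<Rightarrow> complex) \<Rightarrow> 'a \<Rightarrow> complex" where
  "fun_scale c f = (\<lambda>x. c * f x)"

global_interpretation fun_space: vector_space "fun_scale :: complex \<Rightarrow> ('a \<Rightarrow> complex) \<Rightarrow> 'a \<Rightarrow> complex"
  by standard (auto simp: fun_scale_def fun_eq_iff algebra_simps)

definition dual_space :: "(complex \<Rightarrow> 'a::ab_group_add \<Rightarrow> 'a) \<Rightarrow> ('a \<Rightarrow> complex) set" where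
  "dual_space scale = {\<alpha>. Vector_Spaces.linear scale (*) \<alpha>}"

definition dup_space ::
    "(complex \<Rightarrow> 'a::ab_group_add \<Rightarrow> 'a) \<Rightarrow> ('a \<Rightarrow> 'a \<Rightarrow> 'a) \<Rightarrow> ('a \<Rightarrow> 'a \<Rightarrow> complex) \<Rightarrow>
     ('a \<Rightarrow> complex) set" where
  "dup_space scale bracket B =
     {\<alpha> \<in> dual_space scale. wedge_1_3 \<alpha> (assoc_3form bracket B) = 0}"

definition dup_number ::
    "(complex \<Rightarrow> 'a::ab_group_add \<Rightarrow> 'a) \<Rightarrow> ('a \<Rightarrow> 'a \<Rightarrow> 'a) \<Rightarrow> ('a \<Rightarrow> 'a \<Rightarrow> complex) \<Rightarrow> nat" where
  "dup_number scale bracket B = vector_space.dim fun_scale (dup_space scale bracket B)"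

lemma subspace_dual_space:
  fixes scale :: "complex \<Rightarrow> 'a::ab_group_add \<Rightarrow> 'a"
  assumes "vector_space scale"
  shows "fun_space.subspace (dual_space scale)"
proof -
  have vs: "vector_space ((*) :: complex \<Rightarrow> complex \<Rightarrow> complex)"
    by standard (auto simp: algebra_simps)
  show ?thesis
    unfolding fun_space.subspace_def dual_space_def
    using vs assms
    by (auto simp: Vector_Spaces.linear_iff fun_scale_def algebra_simps)
qed

lemma subspace_dup_space:
  fixes scale :: "complex \<Rightarrow> 'a::ab_group_add \<Rightarrow> 'a"
  assumes "vector_space scale"
  shows "fun_space.subspace (dup_space scale bracket B)"
proof -
  have "fun_space.subspace
      {\<alpha> :: 'a \<Rightarrow> complex. wedge_1_3 \<alpha> (assoc_3form bracket B) = 0}"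
    unfolding fun_space.subspace_def
  proof (intro conjI ballI allI; clarsimp simp: fun_eq_iff wedge_1_3_def)
    fix f g :: "'a \<Rightarrow> complex" and x y z w
    let ?I = "assoc_3form bracket B"
    assume f: "\<forall>x y z w. f x * ?I y z w - f y * ?I x z w + f z * ?I x y w = f w * ?I x y z"
      and g: "\<forall>x y z w. g x * ?I y z w - g y * ?I x z w + g z * ?I x y w = g w * ?I x y z"
    show "(f x + g x) * ?I y z w - (f y + g y) * ?I x z w + (f z + g z) * ?I x y w
      = (f w + g w) * ?I x y z"
      using f[rule_format, of x y z w] g[rule_format, of x y z w] by algebra
  next
    fix c and f :: "'a \<Rightarrow> complex" and x y z w
    let ?I = "assoc_3form bracket B"
    assume f: "\<forall>x y z w. f x * ?I y z w - f y * ?I x z w + f z * ?I x y w = f w * ?I x y z"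
    show "fun_scale c f x * ?I y z w - fun_scale c f y * ?I x z w + fun_scale c f z * ?I x y w
      = fun_scale c f w * ?I x y z"
      unfolding fun_scale_def using f[rule_format, of x y z w] by algebra
  qed
  moreover have "dup_space scale bracket B =
      dual_space scale \<inter> {\<alpha>. wedge_1_3 \<alpha> (assoc_3form bracket B) = 0}"
    by (auto simp: dup_space_def)
  ultimately show ?thesis
    using fun_space.subspace_inter[OF subspace_dual_space[OF assms]] by simp
qed

end

theory Submission
  imports Defs
begin

text \<open>
  The dup-number depends on the form \<open>B\<close> only through the 3-form \<open>I(x,y,z) = B([x,y],z)\<close>, and
  the point is that the space \<open>{\<alpha>. \<alpha> \<and> I = 0}\<close> itself, not only its dimension, is the same for
  every quadratic structure on a fixed Lie algebra.

  Let \<open>\<alpha> \<noteq> 0\<close> with kernel \<open>K\<close>. For an alternating trilinear \<open>I\<close>, the equation \<open>\<alpha> \<and> I = 0\<close> says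
  that \<open>I\<close> vanishes on \<open>K\<close>. For \<open>I(x,y,z) = B([x,y],z)\<close> this means that \<open>[K,K]\<close> is orthogonal
  to the hyperplane \<open>K\<close>, so, since \<open>B\<close> is non-degenerate, any two vectors of \<open>[K,K]\<close> are
  proportional (lemma \<open>brackets_in_kernel_proportional\<close>). This conclusion no longer mentions a
  form. Now let \<open>C\<close> be another invariant form and \<open>x, y, z \<in> K\<close>. If \<open>[x,z] = 0\<close>, then
  \<open>C([x,y],z) = - C([x,z],y) = 0\<close>. Otherwise \<open>[x,y]\<close> is a multiple of \<open>[x,z]\<close>, and
  \<open>C([x,z],z) = C(x,[z,z]) = 0\<close>. Either way the 3-form of \<open>C\<close> vanishes on \<open>K\<close>, so it is killed
  by \<open>\<alpha>\<close> as well (lemma \<open>dup_space_subset\<close>).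

  An isomorphism \<open>\<phi>\<close> turns the form of the second algebra into a second form on the first one, and
  composition with \<open>\<phi>\<close> identifies the two spaces of linear forms.
\<close>

section \<open>Linear forms that annihilate an alternating 3-form\<close>

context quadratic_lie_algebra
begin

lemma form_add_left: "B (x + y) z = B x z + B y z"
  and form_add_right: "B x (y + z) = B x y + B x z"
  and form_scale_left: "B (scale c x) z = c * B x z"
  and form_scale_right: "B x (scale c z) = c * B x z"
  and bracket_add_left: "bracket (x + y) z = bracket x z + bracket y z"
  and bracket_add_right: "bracket x (y + z) = bracket x y + bracket x z"
  and bracket_scale_left: "bracket (scale c x) z = scale c (bracket x z)"
  and bracket_scale_right: "bracket x (scale c z) = scale c (bracket x z)"
  using linear_form_left linear_form_right linear_bracket_left linear_bracket_right
  by (simp_all add: Vector_Spaces.linear_iff)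

lemmas form_bracket_multilinear =
  form_add_left form_add_right form_scale_left form_scale_right
  bracket_add_left bracket_add_right bracket_scale_left bracket_scale_right

lemma form_zero_left [simp]: "B 0 x = 0"
  using form_scale_left[of 0 0 x] by simp

lemma bracket_swap: "bracket y x = - bracket x y"
proof -
  have "bracket (x + y) (x + y) = bracket y x + bracket x y"
    unfolding bracket_add_left bracket_add_right by (simp add: bracket_self add.commute)
  then have "bracket y x + bracket x y = 0"
    by (simp only: bracket_self)
  then show ?thesis
    by (simp add: eq_neg_iff_add_eq_0)
qed

lemma form_uminus_left: "B (- x) y = - B x y"
  using form_scale_left[of "-1" x y] by simp

lemma form_bracket_swap12: "B (bracket y x) z = - B (bracket x y) z"
  by (metis bracket_swap form_uminus_left)

lemma form_bracket_repeat23: "B (bracket x y) y = 0"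
  by (metis form_invariant bracket_self form_symmetric form_zero_left)

lemma form_bracket_swap23: "B (bracket x z) y = - B (bracket x y) z"
proof -
  have "B (bracket x (y + z)) (y + z) = 0"
    by (rule form_bracket_repeat23)
  then have "B (bracket x z) y + B (bracket x y) z = 0"
    by (simp add: form_bracket_multilinear form_bracket_repeat23)
  then show ?thesis
    by (simp add: eq_neg_iff_add_eq_0)
qed

text \<open>A 3-form vanishing on the hyperplane \<open>ker \<alpha>\<close> is divisible by \<open>\<alpha>\<close>: with \<open>\<alpha> t = 1\<close>, every
  vector is its \<open>\<alpha>\<close>-multiple of \<open>t\<close> plus a vector of the kernel, and expanding the 3-form along
  this splitting leaves only terms with exactly one factor \<open>t\<close>.\<close>

lemma wedge_eq_0_if_vanishes_on_kernel:
  assumes lin: "Vector_Spaces.linear scale (*) \<alpha>"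
    and t: "\<alpha> t = 1"
    and vanish: "\<And>x y z. \<alpha> x = 0 \<Longrightarrow> \<alpha> y = 0 \<Longrightarrow> \<alpha> z = 0 \<Longrightarrow> B (bracket x y) z = 0"
  shows "wedge_1_3 \<alpha> (assoc_3form bracket B) = 0"
proof -
  have add: "\<alpha> (x + y) = \<alpha> x + \<alpha> y" and scl: "\<alpha> (scale c x) = c * \<alpha> x" for x y c
    using lin by (simp_all add: Vector_Spaces.linear_iff)
  have expand: "B (bracket x y) z =
      \<alpha> x * B (bracket t y) z - \<alpha> y * B (bracket t x) z + \<alpha> z * B (bracket t x) y" for x y z
  proof -
    define p where "p v = v + scale (- \<alpha> v) t" for v
    have p: "\<alpha> (p v) = 0" for v
      unfolding p_def add scl t by simp
    have "B (bracket (p x) (p y)) (p z) = 0"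
      by (intro vanish p)
    moreover have "B (bracket t v) t = 0" for v
      using form_bracket_swap23[of t t v] by (simp add: bracket_self)
    moreover have "B (bracket x t) z = - B (bracket t x) z"
      "B (bracket x y) t = B (bracket t x) y"
      by (metis form_bracket_swap12, metis form_bracket_swap12 form_bracket_swap23 minus_minus)
    ultimately show ?thesis
      unfolding p_def form_bracket_multilinear
      by (simp add: bracket_self form_bracket_repeat23 algebra_simps)
  qed
  have "wedge_1_3 \<alpha> (assoc_3form bracket B) x y z w = 0" for x y z w
    unfolding wedge_1_3_def assoc_3form_def
      expand[of y z w] expand[of x z w] expand[of x y w] expand[of x y z]
    by (simp add: algebra_simps)
  then show ?thesis
    by (simp add: fun_eq_iff)
qed

section \<open>Independence of the quadratic structure\<close>

text \<open>On the kernel, \<open>\<alpha> \<and> I = 0\<close> evaluated at \<open>x, y, w, t\<close> says that \<open>B [x,y]\<close> is a multiple of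
  \<open>\<alpha>\<close>.\<close>

lemma form_bracket_kernel:
  assumes "wedge_1_3 \<alpha> (assoc_3form bracket B) = 0"
    and "\<alpha> t = 1" and "\<alpha> x = 0" and "\<alpha> y = 0"
  shows "B (bracket x y) w = B (bracket x y) t * \<alpha> w"
proof -
  have "wedge_1_3 \<alpha> (assoc_3form bracket B) x y w t = 0"
    using assms(1) by simp
  then show ?thesis
    using assms(2-4) by (simp add: wedge_1_3_def assoc_3form_def mult.commute)
qed

text \<open>Two vectors whose \<open>B\<close>-duals are multiples of \<open>\<alpha>\<close> are proportional by non-degeneracy. The
  relation is stated so that it holds if one of the brackets is zero; the second claim says that
  its coefficient is zero in this case only.\<close>

lemma brackets_in_kernel_proportional:
  assumes wedge: "wedge_1_3 \<alpha> (assoc_3form bracket B) = 0" and t: "\<alpha> t = 1"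
    and ker: "\<alpha> x = 0" "\<alpha> y = 0" "\<alpha> x' = 0" "\<alpha> y' = 0"
  shows "scale (B (bracket x' y') t) (bracket x y) = scale (B (bracket x y) t) (bracket x' y')"
    and "B (bracket x y) t = 0 \<Longrightarrow> bracket x y = 0"
proof -
  note u = form_bracket_kernel[of \<alpha> t x y, OF wedge t ker(1,2)]
  note v = form_bracket_kernel[of \<alpha> t x' y', OF wedge t ker(3,4)]
  show "B (bracket x y) t = 0 \<Longrightarrow> bracket x y = 0"
    using u by (intro form_nondegenerate) (metis mult_zero_left)
  let ?d = "scale (B (bracket x' y') t) (bracket x y) + scale (- B (bracket x y) t) (bracket x' y')"
  have "B ?d w = 0" for w
    unfolding form_add_left form_scale_left using u[of w] v[of w] by algebra
  then have "?d = 0"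
    by (intro form_nondegenerate) simp
  then show "scale (B (bracket x' y') t) (bracket x y) = scale (B (bracket x y) t) (bracket x' y')"
    by simp
qed

lemma dup_space_subset:
  assumes "quadratic_lie_algebra scale bracket C"
  shows "dup_space scale bracket B \<subseteq> dup_space scale bracket C"
proof
  interpret C: quadratic_lie_algebra scale bracket C
    by fact
  fix \<alpha> assume "\<alpha> \<in> dup_space scale bracket B"
  then have lin: "Vector_Spaces.linear scale (*) \<alpha>"
    and wedge: "wedge_1_3 \<alpha> (assoc_3form bracket B) = 0"
    by (simp_all add: dup_space_def dual_space_def)
  have "wedge_1_3 \<alpha> (assoc_3form bracket C) = 0"
  proof (cases "\<forall>x. \<alpha> x = 0")
    case True
    then show ?thesis
      by (simp add: fun_eq_iff wedge_1_3_def)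
  next
    case False
    then obtain s where s: "\<alpha> s \<noteq> 0"
      by auto
    define t where "t = scale (inverse (\<alpha> s)) s"
    have t: "\<alpha> t = 1"
      using lin s by (simp add: t_def Vector_Spaces.linear_iff)
    show ?thesis
    proof (rule C.wedge_eq_0_if_vanishes_on_kernel[OF lin t])
      fix x y z
      assume ker: "\<alpha> x = 0" "\<alpha> y = 0" "\<alpha> z = 0"
      show "C (bracket x y) z = 0"
      proof (cases "bracket x z = 0")
        case True
        then show ?thesis
          using C.form_bracket_swap23[of x y z] by simp
      next
        case False
        then have "B (bracket x z) t \<noteq> 0"
          using brackets_in_kernel_proportional(2)[of \<alpha> t x z x z] wedge t ker by blast
        moreover have "B (bracket x z) t * C (bracket x y) z = B (bracket x y) t * C (bracket x z) z"
          using brackets_in_kernel_proportional(1)[of \<alpha> t x y x z, OF wedge t] ker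
          by (metis C.form_scale_left)
        ultimately show ?thesis
          by (simp add: C.form_bracket_repeat23)
      qed
    qed
  qed
  with lin show "\<alpha> \<in> dup_space scale bracket C"
    by (simp add: dup_space_def dual_space_def)
qed

lemma dup_space_independent_of_form:
  assumes "quadratic_lie_algebra scale bracket C"
  shows "dup_space scale bracket B = dup_space scale bracket C"
  using dup_space_subset[OF assms]
    quadratic_lie_algebra.dup_space_subset[OF assms quadratic_lie_algebra_axioms]
  by (rule subset_antisym)

end

section \<open>Transport along an isomorphism\<close>

lemma linear_inv_bij:
  assumes "Vector_Spaces.linear s s' \<phi>" and "bij \<phi>"
  shows "Vector_Spaces.linear s' s (inv \<phi>)"
  using assms unfolding Vector_Spaces.linear_iff
  by (metis bij_inv_eq_iff)

lemma quadratic_lie_algebra_pullback: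
  assumes "complex_lie_algebra scale bracket"
    and Q': "quadratic_lie_algebra scale' bracket' B'"
    and iso: "lie_algebra_iso scale bracket scale' bracket' \<phi>"
  shows "quadratic_lie_algebra scale bracket (\<lambda>x y. B' (\<phi> x) (\<phi> y))"
proof -
  interpret complex_lie_algebra scale bracket
    by fact
  interpret Q': quadratic_lie_algebra scale' bracket' B'
    by fact
  have lin: "Vector_Spaces.linear scale scale' \<phi>" and bij: "bij \<phi>"
    and hom: "\<And>x y. \<phi> (bracket x y) = bracket' (\<phi> x) (\<phi> y)"
    using iso by (auto simp: lie_algebra_iso_def)
  show ?thesis
  proof (intro quadratic_lie_algebra.intro quadratic_lie_algebra_axioms.intro)
    show "complex_lie_algebra scale bracket"
      by fact
    show "Vector_Spaces.linear scale (*) (\<lambda>x. B' (\<phi> x) (\<phi> y))" for y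
      using Vector_Spaces.linear_compose[OF lin Q'.linear_form_left] by (simp add: o_def)
    show "Vector_Spaces.linear scale (*) (\<lambda>y. B' (\<phi> x) (\<phi> y))" for x
      using Vector_Spaces.linear_compose[OF lin Q'.linear_form_right] by (simp add: o_def)
    show "B' (\<phi> x) (\<phi> y) = B' (\<phi> y) (\<phi> x)" for x y
      by (rule Q'.form_symmetric)
    show "B' (\<phi> (bracket x y)) (\<phi> z) = B' (\<phi> x) (\<phi> (bracket y z))" for x y z
      by (simp add: hom Q'.form_invariant)
    show "x = 0" if "\<forall>y. B' (\<phi> x) (\<phi> y) = 0" for x
    proof -
      have "\<phi> x = 0"
        using that bij by (intro Q'.form_nondegenerate) (metis bij_pointE)
      moreover have "\<phi> 0 = 0"
        using lin by (metis Vector_Spaces.linear_iff add_cancel_right_right)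
      ultimately show ?thesis
        using bij by (metis bij_pointE)
    qed
  qed
qed

lemma dup_space_pullback:
  assumes iso: "lie_algebra_iso scale bracket scale' bracket' \<phi>"
  shows "dup_space scale bracket (\<lambda>x y. B' (\<phi> x) (\<phi> y)) =
    (\<lambda>\<beta>. \<beta> \<circ> \<phi>) ` dup_space scale' bracket' B'" (is "?L = ?R")
proof -
  have lin: "Vector_Spaces.linear scale scale' \<phi>" and bij: "bij \<phi>"
    and hom: "\<And>x y. \<phi> (bracket x y) = bracket' (\<phi> x) (\<phi> y)"
    using iso by (auto simp: lie_algebra_iso_def)
  have wedge: "wedge_1_3 (\<beta> \<circ> \<phi>) (assoc_3form bracket (\<lambda>x y. B' (\<phi> x) (\<phi> y))) x y z w =
      wedge_1_3 \<beta> (assoc_3form bracket' B') (\<phi> x) (\<phi> y) (\<phi> z) (\<phi> w)" for \<beta> x y z w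
    by (simp add: wedge_1_3_def assoc_3form_def hom)
  have mem: "\<beta> \<circ> \<phi> \<in> ?L \<longleftrightarrow> \<beta> \<in> dup_space scale' bracket' B'" for \<beta>
  proof -
    have "Vector_Spaces.linear scale (*) (\<beta> \<circ> \<phi>) \<longleftrightarrow> Vector_Spaces.linear scale' (*) \<beta>"
    proof
      assume "Vector_Spaces.linear scale (*) (\<beta> \<circ> \<phi>)"
      then have "Vector_Spaces.linear scale' (*) ((\<beta> \<circ> \<phi>) \<circ> inv \<phi>)"
        by (rule Vector_Spaces.linear_compose[OF linear_inv_bij[OF lin bij]])
      then show "Vector_Spaces.linear scale' (*) \<beta>"
        using bij by (simp add: o_assoc[symmetric] bij_is_surj surj_iff[THEN iffD1])
    qed (rule Vector_Spaces.linear_compose[OF lin])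
    moreover have "wedge_1_3 (\<beta> \<circ> \<phi>) (assoc_3form bracket (\<lambda>x y. B' (\<phi> x) (\<phi> y))) = 0 \<longleftrightarrow>
        wedge_1_3 \<beta> (assoc_3form bracket' B') = 0"
      unfolding fun_eq_iff wedge zero_fun_def using bij by (metis bij_pointE)
    ultimately show ?thesis
      by (simp add: dup_space_def dual_space_def)
  qed
  show ?thesis
  proof
    show "?R \<subseteq> ?L"
      using mem by blast
    show "?L \<subseteq> ?R"
    proof
      fix \<alpha> assume "\<alpha> \<in> ?L"
      moreover have "\<alpha> = (\<alpha> \<circ> inv \<phi>) \<circ> \<phi>"
        using bij by (simp add: fun_eq_iff bij_is_inj)
      ultimately show "\<alpha> \<in> ?R"
        using mem by (metis imageI)
    qed
  qed
qed

text \<open>The space of all functions is infinite-dimensional, so the dimension of the image is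
  computed from a basis that is carried over.\<close>

lemma dim_fun_space_comp_surj:
  fixes \<phi> :: "'a \<Rightarrow> 'b" and S :: "('b \<Rightarrow> complex) set"
  assumes "surj \<phi>"
  shows "fun_space.dim ((\<lambda>\<beta>. \<beta> \<circ> \<phi>) ` S) = fun_space.dim S"
proof -
  let ?P = "\<lambda>\<beta> :: 'b \<Rightarrow> complex. \<beta> \<circ> \<phi>"
  interpret P: Vector_Spaces.linear fun_scale fun_scale ?P
    by unfold_locales (auto simp: fun_scale_def fun_eq_iff algebra_simps)
  have inj: "inj_on ?P A" for A
    using assms by (auto intro!: inj_onI simp: fun_eq_iff) (metis surjD)
  obtain A where A: "A \<subseteq> S" "fun_space.independent A" "S \<subseteq> fun_space.span A"
    "card A = fun_space.dim S"
    using fun_space.basis_exists[of S] by metis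
  have "fun_space.span A = fun_space.span S"
    using A by (metis fun_space.span_eq fun_space.span_superset subset_trans)
  then have "fun_space.span (?P ` A) = fun_space.span (?P ` S)"
    by (simp add: P.span_image)
  moreover have "fun_space.independent (?P ` A)"
    using A(2) inj by (rule P.independent_injective_image)
  ultimately have "fun_space.dim (?P ` S) = card (?P ` A)"
    by (metis fun_space.dim_eq_card)
  then show ?thesis
    using A(4) card_image[OF inj] by simp
qed

theorem theorem8:
  fixes scale :: "complex \<Rightarrow> 'a::ab_group_add \<Rightarrow> 'a"
    and bracket :: "'a \<Rightarrow> 'a \<Rightarrow> 'a"
    and B :: "'a \<Rightarrow> 'a \<Rightarrow> complex"
    and scale' :: "complex \<Rightarrow> 'b::ab_group_add \<Rightarrow> 'b"
    and bracket' :: "'b \<Rightarrow> 'b \<Rightarrow> 'b"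
    and B' :: "'b \<Rightarrow> 'b \<Rightarrow> complex"
  assumes "quadratic_lie_algebra scale bracket B"
    and "quadratic_lie_algebra scale' bracket' B'"
    and "\<exists>\<phi>. lie_algebra_iso scale bracket scale' bracket' \<phi>"
  shows "dup_number scale bracket B = dup_number scale' bracket' B'"
proof -
  from assms(3) obtain \<phi> where iso: "lie_algebra_iso scale bracket scale' bracket' \<phi>"
    by blast
  have "dup_space scale bracket B = dup_space scale bracket (\<lambda>x y. B' (\<phi> x) (\<phi> y))"
    using assms(1) quadratic_lie_algebra_pullback[OF quadratic_lie_algebra.axioms(1)[OF assms(1)] assms(2) iso]
    by (rule quadratic_lie_algebra.dup_space_independent_of_form)
  also have "\<dots> = (\<lambda>\<beta>. \<beta> \<circ> \<phi>) ` dup_space scale' bracket' B'"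
    by (rule dup_space_pullback[OF iso])
  finally show ?thesis
    using iso dim_fun_space_comp_surj[of \<phi>]
    by (simp add: dup_number_def lie_algebra_iso_def bij_is_surj)
qed

end
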